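(* Let $\Theta$ and $\mathcal C$ be the polyhedra $\Theta=\{x\in\mathbb R^n\mid \langle a_i,x\rangle\le b_i\ \forall i\in I_1\}$ and $\mathcal C=\{x\in\mathbb R^n\mid \langle a_i,x\rangle\le 0\ \forall i\in I_2\}$, and let $\mathcal N$ be the normal cone mapping to $\Theta$. Let $\bar x\in\mathcal C$ and $(\bar x,\bar x^* )\in\operatorname{gph}\mathcal N$. Then the limiting normal cone with respect to $\mathcal C\times\mathbb R^n$ of $\operatorname{gph}\mathcal N$ at $(\bar x,\bar x^* )$ is given by $$N_{\mathcal C\times\mathbb R^n}((\bar x,\bar x^* ),\operatorname{gph}\mathcal N)=\bigcup_{\substack{Q\subset\bar I,\ C_Q\ne\emptyset\\ P\in\mathcal P(\bar x,\bar x^* ),\ P\subset Q|_{I_1}}}(A_{Q,P}\cap\mathcal T_{Q|_{I_2}})\times B_{Q|_{I_1},P},$$ where $\bar I:=I(\bar x)$.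
   Context: Setting: $I_1=\{1,\dots,\ell_1\}$, $I_2=\{\ell_1+1,\dots,\ell\}$, $I=I_1\cup I_2$; $a_i\in\mathbb R^n$ for $i\in I$, $b_i\in\mathbb R$ for $i\in I_1$. Active index sets: $I_1(x)=\{i\in I_1\mid\langle a_i,x\rangle=b_i\}$ for $x\in\Theta$; $I_2(x)=\{i\in I_2\mid\langle a_i,x\rangle=0\}$ for $x\in\mathcal C$; $I(x)=I_1(x)\cup I_2(x)$ for $x\in\Theta\cap\mathcal C$. Normal cone mapping: $\mathcal N(x)=N(x,\Theta)$ (the usual normal cone to the convex set $\Theta$, equal to $\operatorname{cone}\{a_i\mid i\in I_1(x)\}$) if $x\in\Theta$, and $\mathcal N(x)=\emptyset$ otherwise; $\operatorname{gph}\mathcal N=\{(x,x^* )\mid x^*\in\mathcal N(x)\}$. For $Q\subset I$: $Q|_{I_j}=Q\cap I_j$ ($j=1,2$), $\mathcal T_Q=\{u\in\mathbb R^n\mid\langle a_i,u\rangle\le 0\ \forall i\in Q\}$, and $C_Q=\{x\in\mathbb R^n\mid\langle a_i,x\rangle=0\ \forall i\in Q,\ \langle a_i,x\rangle<0\ \forall i\in I\setminus Q\}$. For $P\subset Q\subset I$ with $P\subset I_1$: $B_{Q,P}=\{u\in\mathcal T_Q\mid\langle a_i,u\rangle=0\ \forall i\in P\}$, $A_{Q,P}=\operatorname{cone}\{a_i\mid i\in Q\setminus P\}+\operatorname{span}\{a_i\mid i\in P\}$. Also $\mathcal P(\bar x,\bar x^* )=\{P\subset I_1(\bar x)\mid\bar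 x^*\in\operatorname{cone}\{a_i\mid i\in P\}\}$. Here $\operatorname{cone}$ is the convex cone generated (nonnegative combinations), $\operatorname{cone}\emptyset=\operatorname{span}\emptyset=\{0\}$, $\mathcal T_\emptyset=\mathbb R^n$. Normal cones with respect to a set: for nonempty $\Omega,\mathcal D\subset\mathbb R^s$ with $\mathcal D$ closed and convex, and $\bar z\in\Omega\cap\mathcal D$, $$\hat N_{\mathcal D}(\bar z,\Omega)=\Big\{z^*\ \Big|\ \exists p>0:\ \bar z+pz^*\in\mathcal D,\ \limsup_{z\to\bar z,\ z\in\Omega\cap\mathcal D}\frac{\langle z^*,z-\bar z\rangle}{\|z-\bar z\|}\le 0\Big\}$$ (Fréchet), and the limiting normal cone $N_{\mathcal D}(\bar z,\Omega)$ is the set of all $z^*$ for which there exist $z_k\to\bar z$ with $z_k\in\Omega\cap\mathcal D$ and $z_k^*\to z^*$ with $z_k^*\in\hat N_{\mathcal D}(z_k,\Omega)$.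
   Formalization: In C_Q the strict inequalities are required only for i in Ī\Q (indices active at x̄) instead of all i in I\Q; with I\Q the formula fails, e.g. for Θ=[-1,0], I_2=∅, x̄=0, x̄*=0, where no Q is admitted. *)

theory Defs
  imports "HOL-Analysis.Analysis"
begin

text \<open>
  Normal cones with respect to a set. The limes superior is taken in the extended reals along
  \<open>at z within (\<Omega> \<inter> D)\<close>, i.e. over \<open>w \<noteq> z\<close>; at an isolated point of \<open>\<Omega> \<inter> D\<close> it is \<open>-\<infinity>\<close> and
  the condition is void. The definition is meaningful only for \<open>z \<in> \<Omega> \<inter> D\<close>.
\<close>

definition frechet_normal_wrt ::
    "'a::euclidean_space set \<Rightarrow> 'a \<Rightarrow> 'a set \<Rightarrow> 'a set" where
  "frechet_normal_wrt D z \<Omega> =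
     {zs. (\<exists>p>0. z + p *\<^sub>R zs \<in> D) \<and>
          Limsup (at z within (\<Omega> \<inter> D)) (\<lambda>w. ereal ((zs \<bullet> (w - z)) / norm (w - z))) \<le> 0}"

definition limiting_normal_wrt ::
    "'a::euclidean_space set \<Rightarrow> 'a \<Rightarrow> 'a set \<Rightarrow> 'a set" where
  "limiting_normal_wrt D z \<Omega> =
     {zs. \<exists>zk zsk. zk \<longlonglongrightarrow> z \<and> (\<forall>k::nat. zk k \<in> \<Omega> \<inter> D) \<and>
                   zsk \<longlonglongrightarrow> zs \<and> (\<forall>k. zsk k \<in> frechet_normal_wrt D (zk k) \<Omega>)}"

definition normal_cone_map :: "'a::euclidean_space set \<Rightarrow> 'a \<Rightarrow> 'a set" where
  "normal_cone_map \<Theta> x = (if x \<in> \<Theta> then {xs. \<forall>y\<in>\<Theta>. xs \<bullet> (y - x) \<le> 0} else {})"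

definition gph :: "('a \<Rightarrow> 'b set) \<Rightarrow> ('a \<times> 'b) set" where
  "gph F = {(x, xs). xs \<in> F x}"

definition active1 :: "(nat \<Rightarrow> 'a::euclidean_space) \<Rightarrow> (nat \<Rightarrow> real) \<Rightarrow> nat set \<Rightarrow> 'a \<Rightarrow> nat set" where
  "active1 a b I1 x = {i \<in> I1. a i \<bullet> x = b i}"

definition active2 :: "(nat \<Rightarrow> 'a::euclidean_space) \<Rightarrow> nat set \<Rightarrow> 'a \<Rightarrow> nat set" where
  "active2 a I2 x = {i \<in> I2. a i \<bullet> x = 0}"

definition T_cone :: "(nat \<Rightarrow> 'a::euclidean_space) \<Rightarrow> nat set \<Rightarrow> 'a set" where
  "T_cone a Q = {u. \<forall>i\<in>Q. a i \<bullet> u \<le> 0}"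

text \<open>
  The set \<open>C\<^sub>Q\<close> relative to an ambient index set \<open>J\<close>. It has to be used with \<open>J\<close> the set of indices
  active at the reference point: then, for \<open>Q \<subseteq> J\<close>, it is nonempty iff there are feasible points
  arbitrarily close to the reference point whose active index set is exactly \<open>Q\<close>. Taking all indices
  for \<open>J\<close> would impose homogeneous conditions coming from inactive constraints; e.g. for
  \<open>\<Theta> = {-1..0}\<close> on the real line (with no constraints of the second kind) and the point \<open>0\<close>, no
  \<open>Q\<close> at all would be admitted.
\<close>

definition C_face :: "(nat \<Rightarrow> 'a::euclidean_space) \<Rightarrow> nat set \<Rightarrow> nat set \<Rightarrow> 'a set" where
  "C_face a J Q = {x. (\<forall>i\<in>Q. a i \<bullet> x = 0) \<and> (\<forall>i\<in>J - Q. a i \<bullet> x < 0)}"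

definition B_cone :: "(nat \<Rightarrow> 'a::euclidean_space) \<Rightarrow> nat set \<Rightarrow> nat set \<Rightarrow> 'a set" where
  "B_cone a Q P = {u \<in> T_cone a Q. \<forall>i\<in>P. a i \<bullet> u = 0}"

definition A_cone :: "(nat \<Rightarrow> 'a::euclidean_space) \<Rightarrow> nat set \<Rightarrow> nat set \<Rightarrow> 'a set" where
  "A_cone a Q P = {v + w | v w. v \<in> convex_cone hull (a ` (Q - P)) \<and> w \<in> span (a ` P)}"

definition P_family ::
    "(nat \<Rightarrow> 'a::euclidean_space) \<Rightarrow> (nat \<Rightarrow> real) \<Rightarrow> nat set \<Rightarrow> 'a \<Rightarrow> 'a \<Rightarrow> nat set set" where
  "P_family a b I1 x xs = {P. P \<subseteq> active1 a b I1 x \<and> xs \<in> convex_cone hull (a ` P)}"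

end

theory Submission
  imports Defs
begin

text \<open>
  At a point \<open>(x, x\<^sup>*)\<close> of the graph, with \<open>Q\<close> the set of active indices of \<open>x\<close> and \<open>x\<^sup>*\<close> a combination
  of \<open>a\<^sub>i\<close>, \<open>i \<in> P\<close>, with strictly positive coefficients, the Frechet normal cone is exactly
  \<open>(A_cone a Q P \<inter> T_cone a (Q \<inter> I2)) \<times> B_cone a (Q \<inter> I1) P\<close>. One inclusion tests a normal against the
  directions \<open>(u, 0)\<close> and \<open>(0, \<plusminus>a\<^sub>i)\<close> and applies Farkas' lemma. For the other, only finitely many closed
  cones occur as normal cones, so \<open>x\<^sup>*\<close> is normal at every graph point \<open>(y, y\<^sup>*)\<close> close to \<open>(x, x\<^sup>*)\<close>; hence
  \<open>x\<^sup>*\<close> vanishes on \<open>y - x\<close>, and strict positivity of the coefficients keeps all of \<open>P\<close> active at \<open>y\<close>.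

  The limiting normals at the reference point are then governed by the finitely many pairs \<open>(Q, P)\<close> occurring
  nearby: every piece is closed, and conversely a pair with \<open>u \<in> C_face\<close> and \<open>x\<^sup>* \<in> cone {a\<^sub>i | i \<in> P}\<close> is
  realised at \<open>(x + t u, x\<^sup>* + t \<Sum>\<^sub>P a\<^sub>i)\<close> for all small \<open>t > 0\<close>.
\<close>

section \<open>Finitely generated cones\<close>

lemma convex_cone_hull_inner_nonpos:
  assumes "v \<in> convex_cone hull S" and "\<And>s. s \<in> S \<Longrightarrow> s \<bullet> u \<le> 0"
  shows "v \<bullet> u \<le> 0"
proof -
  have "convex_cone hull S \<subseteq> {x. u \<bullet> x \<le> 0}"
    by (rule hull_minimal[where S = convex_cone, OF _ convex_cone_halfspace_le])
      (use assms(2) in \<open>auto simp: inner_commute\<close>)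
  then show ?thesis using assms(1) by (auto simp: inner_commute)
qed

text \<open>A finitely generated cone is closed, so a point outside it can be strictly separated
  from it. Since the cone contains 0 and is stable under positive scaling, the separating functional
  is nonnegative on all generators, and its negative violates the hypothesis at
  \<open>z\<close>.\<close>

lemma farkas_convex_cone_hull:
  fixes S :: "'a::euclidean_space set"
  assumes "finite S" and "\<And>u. (\<And>s. s \<in> S \<Longrightarrow> s \<bullet> u \<le> 0) \<Longrightarrow> z \<bullet> u \<le> 0"
  shows "z \<in> convex_cone hull S"
proof (rule ccontr)
  let ?K = "convex_cone hull S"
  assume "z \<notin> ?K"
  then obtain u \<beta> where u: "u \<bullet> z < \<beta>" "\<And>x. x \<in> ?K \<Longrightarrow> u \<bullet> x > \<beta>"
    using separating_hyperplane_closed_point[OF convex_convex_cone_hull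
        closed_convex_cone_hull[OF assms(1)]] by blast
  have "\<beta> < 0" using u(2)[OF convex_cone_hull_contains_0] by simp
  have "s \<bullet> (- u) \<le> 0" if "s \<in> S" for s
  proof (rule ccontr)
    assume "\<not> s \<bullet> (- u) \<le> 0"
    then have neg: "u \<bullet> s < 0" by (simp add: inner_commute)
    \<comment> \<open>This positive multiple of \<open>s\<close> is chosen so that \<open>u\<close>
      takes exactly the value \<open>\<beta>\<close> on it, against the strict separation.\<close>
    have "(\<beta> / (u \<bullet> s)) *\<^sub>R s \<in> ?K"
      using neg \<open>\<beta> < 0\<close> that by (intro convex_cone_hull_mul hull_inc) (auto simp: divide_nonpos_neg)
    from u(2)[OF this] neg show False by simp
  qed
  then have "z \<bullet> (- u) \<le> 0" by (rule assms(2))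
  then show False using u(1) \<open>\<beta> < 0\<close> by (simp add: inner_commute)
qed

text \<open>Discarding the indices with zero coefficient leaves only strictly positive ones. Sums
  run over indices rather than over vectors, so \<open>a\<close> may take a value several
  times.\<close>

lemma convex_cone_hull_image_pos:
  assumes "finite J" and "x \<in> convex_cone hull (a ` J)"
  obtains P c where "P \<subseteq> J" and "\<And>i. i \<in> P \<Longrightarrow> c i > (0::real)" and "x = (\<Sum>i\<in>P. c i *\<^sub>R a i)"
proof -
  let ?S = "{\<Sum>i\<in>J. c i *\<^sub>R a i | c. \<forall>i\<in>J. c i \<ge> (0::real)}"
  have "convex_cone hull (a ` J) \<subseteq> ?S"
  proof (rule hull_minimal)
    show "a ` J \<subseteq> ?S"
    proof clarify
      fix j assume "j \<in> J"
      then have "a j = (\<Sum>i\<in>J. (if i = j then 1 else 0) *\<^sub>R a i)"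
        using assms(1) by (simp add: if_distrib[of "\<lambda>c. c *\<^sub>R _"] cong: if_cong)
      then show "\<exists>c. a j = (\<Sum>i\<in>J. c i *\<^sub>R a i) \<and> (\<forall>i\<in>J. 0 \<le> c i)"
        by (rule exI[of _ "\<lambda>i. if i = j then 1 else 0", OF conjI]) simp
    qed
    show "convex_cone ?S"
      unfolding convex_cone_iff
    proof (intro conjI ballI allI impI)
      show "0 \<in> ?S" unfolding mem_Collect_eq by (rule exI[of _ "\<lambda>_. 0"]) simp
    next
      fix x y assume "x \<in> ?S" "y \<in> ?S"
      then obtain c d where "x = (\<Sum>i\<in>J. c i *\<^sub>R a i)" "y = (\<Sum>i\<in>J. d i *\<^sub>R a i)"
        "\<forall>i\<in>J. c i \<ge> 0" "\<forall>i\<in>J. d i \<ge> 0" by auto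
      then show "x + y \<in> ?S"
        unfolding mem_Collect_eq
        by (intro exI[of _ "\<lambda>i. c i + d i"]) (simp add: scaleR_add_left sum.distrib)
    next
      fix x and t :: real assume "x \<in> ?S" "t \<ge> 0"
      then obtain c where "x = (\<Sum>i\<in>J. c i *\<^sub>R a i)" "\<forall>i\<in>J. c i \<ge> 0" by auto
      then show "t *\<^sub>R x \<in> ?S"
        using \<open>t \<ge> 0\<close> unfolding mem_Collect_eq
        by (intro exI[of _ "\<lambda>i. t * c i"]) (simp add: scaleR_sum_right)
    qed
  qed
  then obtain c where c: "x = (\<Sum>i\<in>J. c i *\<^sub>R a i)" "\<forall>i\<in>J. c i \<ge> 0" using assms(2) by auto
  have "x = (\<Sum>i\<in>{i\<in>J. c i > 0}. c i *\<^sub>R a i)"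
    unfolding c(1) using assms(1) c(2) by (intro sum.mono_neutral_right) (auto simp: order_less_le)
  from _ _ this show ?thesis by (rule that) simp_all
qed

lemma convex_cone_hull_image_mono:
  assumes "P \<subseteq> J" and "x \<in> convex_cone hull (a ` P)"
  shows "x \<in> convex_cone hull (a ` J)"
  using hull_mono[OF image_mono[OF assms(1)], of convex_cone a] assms(2) by blast

lemma sum_in_convex_cone_hull:
  assumes "\<And>i. i \<in> P \<Longrightarrow> c i \<ge> 0"
  shows "(\<Sum>i\<in>P. c i *\<^sub>R a i) \<in> convex_cone hull (a ` P)"
proof -
  have "(\<Sum>i\<in>R. c i *\<^sub>R a i) \<in> convex_cone hull (a ` P)" if "R \<subseteq> P" for R
    using that
  proof (induction R rule: infinite_finite_induct)
    case (insert i R)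
    then show ?case
      using assms by (simp add: convex_cone_hull_add convex_cone_hull_mul hull_inc)
  qed (auto simp: convex_cone_hull_contains_0)
  then show ?thesis by simp
qed

text \<open>Farkas' lemma for the generators of \<open>A_cone\<close>: testing against both signs of
  \<open>a i\<close> for \<open>i\<close> in \<open>P\<close> turns the inequality into an equation,
  so the directions that pass all tests are exactly those in \<open>B_cone\<close>.\<close>

lemma A_cone_eq_polar:
  fixes a :: "nat \<Rightarrow> 'a::euclidean_space"
  assumes "finite Q" and "P \<subseteq> Q"
  shows "A_cone a Q P = {z. \<forall>u\<in>B_cone a Q P. z \<bullet> u \<le> 0}"
proof (intro equalityI subsetI)
  fix z assume "z \<in> A_cone a Q P"
  then obtain v w where z: "z = v + w" and v: "v \<in> convex_cone hull (a ` (Q - P))"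
    and w: "w \<in> span (a ` P)" by (auto simp: A_cone_def)
  have "z \<bullet> u \<le> 0" if u: "u \<in> B_cone a Q P" for u
  proof -
    have "v \<bullet> u \<le> 0"
      by (rule convex_cone_hull_inner_nonpos[OF v]) (use u in \<open>auto simp: B_cone_def T_cone_def\<close>)
    moreover have "u \<bullet> w = 0"
      using orthogonal_to_span[OF w, of u] u
      by (force simp: orthogonal_def B_cone_def inner_commute)
    ultimately show ?thesis by (simp add: z inner_add_left inner_commute[of w])
  qed
  then show "z \<in> {z. \<forall>u\<in>B_cone a Q P. z \<bullet> u \<le> 0}" by blast
next
  fix z assume z: "z \<in> {z. \<forall>u\<in>B_cone a Q P. z \<bullet> u \<le> 0}"
  let ?S = "a ` (Q - P) \<union> (a ` P \<union> (\<lambda>i. - a i) ` P)"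
  have "z \<in> convex_cone hull ?S"
  proof (rule farkas_convex_cone_hull)
    show "finite ?S" using assms by (auto intro: finite_subset)
    fix u assume u: "\<And>s. s \<in> ?S \<Longrightarrow> s \<bullet> u \<le> 0"
    have P: "a i \<bullet> u = 0" if "i \<in> P" for i
      using u[of "a i"] u[of "- a i"] that by auto
    moreover have "a i \<bullet> u \<le> 0" if "i \<in> Q" for i
      using u[of "a i"] P[of i] that by (cases "i \<in> P") auto
    ultimately show "z \<bullet> u \<le> 0" using z by (auto simp: B_cone_def T_cone_def)
  qed
  then obtain v w where "z = v + w" "v \<in> convex_cone hull (a ` (Q - P))"
    and w: "w \<in> convex_cone hull (a ` P \<union> (\<lambda>i. - a i) ` P)"
    unfolding convex_cone_hull_Un[of "a ` (Q - P)"] by auto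
  moreover have "convex_cone hull (a ` P \<union> (\<lambda>i. - a i) ` P) \<subseteq> span (a ` P)"
    by (rule hull_minimal) (auto simp: convex_cone_span span_base span_neg)
  ultimately show "z \<in> A_cone a Q P" by (auto simp: A_cone_def)
qed

lemma closed_T_cone: "closed (T_cone a Q)"
proof -
  have "T_cone a Q = (\<Inter>i\<in>Q. {u. a i \<bullet> u \<le> 0})" by (auto simp: T_cone_def)
  then show ?thesis by (simp add: closed_INT closed_halfspace_le)
qed

lemma closed_B_cone: "closed (B_cone a Q P)"
proof -
  have "B_cone a Q P = T_cone a Q \<inter> (\<Inter>i\<in>P. {u. a i \<bullet> u = 0})" by (auto simp: B_cone_def)
  then show ?thesis by (simp add: closed_Int closed_INT closed_hyperplane closed_T_cone)
qed

text \<open>A sum of closed cones need not be closed; the polar description exhibits this one as an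
  intersection of closed half-spaces.\<close>

lemma closed_A_cone:
  assumes "finite Q" and "P \<subseteq> Q"
  shows "closed (A_cone a Q P)"
proof -
  have "A_cone a Q P = (\<Inter>u\<in>B_cone a Q P. {z. u \<bullet> z \<le> 0})"
    unfolding A_cone_eq_polar[OF assms] by (auto simp: inner_commute)
  then show ?thesis by (simp add: closed_INT closed_halfspace_le)
qed

section \<open>Local behaviour of closed sets and of polyhedra\<close>

text \<open>By contraposition: the complement of each member of \<open>F\<close> that misses
  \<open>x\<close> is a neighbourhood of \<open>x\<close>, and there are finitely many of
  them.\<close>

lemma eventually_mem_closed_imp_mem:
  fixes x :: "'a::topological_space"
  assumes "finite F" and "\<And>S. S \<in> F \<Longrightarrow> closed S"
  shows "\<forall>\<^sub>F y in nhds x. \<forall>S\<in>F. y \<in> S \<longrightarrow> x \<in> S"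
  unfolding eventually_ball_finite_distrib[OF assms(1)]
proof
  fix S assume "S \<in> F"
  show "\<forall>\<^sub>F y in nhds x. y \<in> S \<longrightarrow> x \<in> S"
  proof (cases "x \<in> S")
    case False
    then have "\<forall>\<^sub>F y in nhds x. y \<in> - S"
      using assms(2)[OF \<open>S \<in> F\<close>] by (intro eventually_nhds_in_open) auto
    then show ?thesis by eventually_elim auto
  qed simp
qed

lemma eventually_inactive:
  fixes a :: "nat \<Rightarrow> 'a::real_inner"
  assumes "finite J" and "\<And>i. i \<in> J \<Longrightarrow> a i \<bullet> x \<le> b i"
  shows "\<forall>\<^sub>F y in nhds x. \<forall>i\<in>J. a i \<bullet> x \<noteq> b i \<longrightarrow> a i \<bullet> y < b i"
  unfolding eventually_ball_finite_distrib[OF assms(1)]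
proof
  fix i assume "i \<in> J"
  show "\<forall>\<^sub>F y in nhds x. a i \<bullet> x \<noteq> b i \<longrightarrow> a i \<bullet> y < b i"
  proof (cases "a i \<bullet> x = b i")
    case False
    then have "a i \<bullet> x < b i" using assms(2)[OF \<open>i \<in> J\<close>] by simp
    then have "\<forall>\<^sub>F y in nhds x. y \<in> {y. a i \<bullet> y < b i}"
      by (intro eventually_nhds_in_open) (auto simp: open_halfspace_lt)
    then show ?thesis by eventually_elim auto
  qed simp
qed

lemma tendsto_along_direction:
  fixes x u :: "'a::real_normed_vector"
  shows "((\<lambda>t. x + t *\<^sub>R u) \<longlongrightarrow> x) (at_right 0)"
proof -
  have "((\<lambda>t. x + t *\<^sub>R u) \<longlongrightarrow> x + 0 *\<^sub>R u) (at_right 0)" by (intro tendsto_intros)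
  then show ?thesis by simp
qed

lemma eventually_along_direction:
  fixes x u :: "'a::real_normed_vector"
  assumes "\<forall>\<^sub>F y in nhds x. R y"
  shows "\<forall>\<^sub>F t in at_right 0. R (x + t *\<^sub>R u)"
  using filterlim_iff[THEN iffD1, OF tendsto_along_direction] assms by blast

lemma eventually_feasible_direction:
  fixes a :: "nat \<Rightarrow> 'a::real_inner"
  assumes "finite J" and "\<And>i. i \<in> J \<Longrightarrow> a i \<bullet> x \<le> b i"
    and "\<And>i. i \<in> J \<Longrightarrow> a i \<bullet> x = b i \<Longrightarrow> a i \<bullet> u \<le> 0"
  shows "\<forall>\<^sub>F t in at_right 0. \<forall>i\<in>J. a i \<bullet> (x + t *\<^sub>R u) \<le> b i"
proof -
  have "\<forall>\<^sub>F y in nhds x. \<forall>i\<in>J. a i \<bullet> x \<noteq> b i \<longrightarrow> a i \<bullet> y < b i"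
    using assms(1,2) by (rule eventually_inactive)
  from eventually_along_direction[OF this, of u] eventually_at_right_less[of 0] show ?thesis
  proof eventually_elim
    case (elim t)
    show ?case
    proof
      fix i assume i: "i \<in> J"
      show "a i \<bullet> (x + t *\<^sub>R u) \<le> b i"
      proof (cases "a i \<bullet> x = b i")
        case True
        then show ?thesis
          using assms(3)[OF i] elim(2) by (simp add: inner_add_right mult_nonneg_nonpos)
      next
        case False
        then show ?thesis using elim(1) i by force
      qed
    qed
  qed
qed

text \<open>Along the ray \<open>z + t *\<^sub>R d\<close> the difference quotient is constant, so a
  bound on its limes superior is a bound on the sign of \<open>zs \<bullet> d\<close>.\<close>

lemma frechet_normal_wrt_direction:
  assumes "zs \<in> frechet_normal_wrt D z \<Omega>"
    and "\<forall>\<^sub>F t in at_right 0. z + t *\<^sub>R d \<in> \<Omega> \<inter> D"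
  shows "zs \<bullet> d \<le> 0"
proof (rule ccontr)
  assume "\<not> zs \<bullet> d \<le> 0"
  then have pos: "zs \<bullet> d > 0" and d: "d \<noteq> 0" by auto
  \<comment> \<open>The constant value of the quotient on the ray. The Limsup bound together with
    \<open>0 < c\<close> would force it to be strictly below itself.\<close>
  define c where "c = zs \<bullet> d / norm d"
  have "\<forall>\<^sub>F t in at_right 0. z + t *\<^sub>R d \<in> \<Omega> \<inter> D \<and> z + t *\<^sub>R d \<noteq> z"
    using assms(2) eventually_at_right_less[of 0] by eventually_elim (use d in auto)
  \<comment> \<open>As \<open>d\<close> is nonzero, the ray avoids \<open>z\<close> for
    \<open>t > 0\<close> and so converges in the punctured filter used by the definition.\<close>
  then have lim: "filterlim (\<lambda>t. z + t *\<^sub>R d) (at z within (\<Omega> \<inter> D)) (at_right 0)"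
    unfolding filterlim_at using tendsto_along_direction by blast
  have "Limsup (at z within (\<Omega> \<inter> D)) (\<lambda>w. ereal ((zs \<bullet> (w - z)) / norm (w - z))) \<le> 0"
    using assms(1) by (simp add: frechet_normal_wrt_def)
  moreover have "0 < ereal c" using pos d by (simp add: c_def)
  ultimately have "\<forall>\<^sub>F w in at z within (\<Omega> \<inter> D). (zs \<bullet> (w - z)) / norm (w - z) < c"
    unfolding Limsup_le_iff less_ereal.simps(1)[symmetric] by blast
  then have "\<forall>\<^sub>F t in at_right 0. (zs \<bullet> (t *\<^sub>R d)) / norm (t *\<^sub>R d) < c"
    using filterlim_iff[THEN iffD1, OF lim] by fastforce
  then have "\<forall>\<^sub>F t in at_right (0::real). False"
    using eventually_at_right_less[of 0] by eventually_elim (simp add: c_def)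
  then show False by simp
qed

section \<open>The graph of the normal cone mapping of a polyhedron\<close>

text \<open>Finiteness gives closed cones and neighbourhoods that serve all indices at once;
  disjointness lets the two active sets be recovered from their union.\<close>

locale polyhedral_pair =
  fixes a :: "nat \<Rightarrow> 'a::euclidean_space" and b :: "nat \<Rightarrow> real" and I1 I2 :: "nat set"
  assumes finite_I1: "finite I1" and finite_I2: "finite I2" and disjoint: "I1 \<inter> I2 = {}"
begin

definition \<Theta> :: "'a set" where "\<Theta> = {x. \<forall>i\<in>I1. a i \<bullet> x \<le> b i}"

definition C :: "'a set" where "C = {x. \<forall>i\<in>I2. a i \<bullet> x \<le> 0}"

definition active :: "'a \<Rightarrow> nat set" where
  "active x = active1 a b I1 x \<union> active2 a I2 x"

abbreviation G :: "('a \<times> 'a) set" where "G \<equiv> gph (normal_cone_map \<Theta>)"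

lemma active_Int_I1: "active x \<inter> I1 = active1 a b I1 x"
  and active_Int_I2: "active x \<inter> I2 = active2 a I2 x"
  using disjoint by (auto simp: active_def active1_def active2_def)

lemma finite_active: "finite (active x)"
  using finite_I1 finite_I2 by (simp add: active_def active1_def active2_def)

lemma finite_active1: "finite (active1 a b I1 x)"
  using finite_I1 by (simp add: active1_def)

text \<open>Only finitely many closed cones are involved. The neighbourhood is uniform in
  \<open>J\<close>, so \<open>J\<close> may later be chosen depending on \<open>ys\<close>.\<close>

lemma eventually_mem_hull_imp_mem:
  "\<forall>\<^sub>F ys in nhds xs. \<forall>J\<subseteq>I1. ys \<in> convex_cone hull (a ` J) \<longrightarrow> xs \<in> convex_cone hull (a ` J)"
proof -
  have "\<forall>\<^sub>F ys in nhds xs. \<forall>S\<in>(\<lambda>J. convex_cone hull (a ` J)) ` Pow I1. ys \<in> S \<longrightarrow> xs \<in> S"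
    by (rule eventually_mem_closed_imp_mem)
      (use finite_I1 in \<open>auto intro!: closed_convex_cone_hull intro: finite_subset\<close>)
  then show ?thesis by eventually_elim auto
qed

text \<open>By Farkas' lemma it suffices to test a normal against directions satisfying the active
  constraints, and these are feasible for small steps.\<close>

lemma normal_cone_map_eq:
  assumes "x \<in> \<Theta>"
  shows "normal_cone_map \<Theta> x = convex_cone hull (a ` active1 a b I1 x)"
proof (intro equalityI subsetI)
  fix xs assume "xs \<in> normal_cone_map \<Theta> x"
  then have xs: "\<And>y. y \<in> \<Theta> \<Longrightarrow> xs \<bullet> (y - x) \<le> 0" using assms by (simp add: normal_cone_map_def)
  show "xs \<in> convex_cone hull (a ` active1 a b I1 x)"
  proof (rule farkas_convex_cone_hull)
    fix u assume "\<And>s. s \<in> a ` active1 a b I1 x \<Longrightarrow> s \<bullet> u \<le> 0"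
    then have "\<forall>\<^sub>F t in at_right 0. \<forall>i\<in>I1. a i \<bullet> (x + t *\<^sub>R u) \<le> b i"
      using assms finite_I1
      by (intro eventually_feasible_direction) (auto simp: \<Theta>_def active1_def)
    \<comment> \<open>The claim does not mention \<open>t\<close>; as \<open>at_right 0\<close> is a
      nontrivial filter, its eventual truth is its truth.\<close>
    then have "\<forall>\<^sub>F t in at_right (0::real). xs \<bullet> u \<le> 0"
      using eventually_at_right_less[of 0]
    proof eventually_elim
      case (elim t)
      then show ?case using xs[of "x + t *\<^sub>R u"] by (simp add: \<Theta>_def mult_le_0_iff)
    qed
    then show "xs \<bullet> u \<le> 0" by simp
  qed (simp add: finite_active1)
next
  fix xs assume xs: "xs \<in> convex_cone hull (a ` active1 a b I1 x)"
  have "xs \<bullet> (y - x) \<le> 0" if "y \<in> \<Theta>" for y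
    by (rule convex_cone_hull_inner_nonpos[OF xs])
      (use that in \<open>auto simp: active1_def \<Theta>_def inner_diff_right\<close>)
  then show "xs \<in> normal_cone_map \<Theta> x" using assms by (simp add: normal_cone_map_def)
qed

lemma mem_G_iff: "(x, xs) \<in> G \<longleftrightarrow> x \<in> \<Theta> \<and> xs \<in> convex_cone hull (a ` active1 a b I1 x)"
proof (cases "x \<in> \<Theta>")
  case True
  then show ?thesis by (simp add: gph_def normal_cone_map_eq)
qed (simp add: gph_def normal_cone_map_def)

section \<open>Active index sets near a feasible point\<close>

lemma eventually_active1_subset:
  assumes "x \<in> \<Theta>"
  shows "\<forall>\<^sub>F y in nhds x. active1 a b I1 y \<subseteq> active1 a b I1 x"
proof -
  have "\<forall>\<^sub>F y in nhds x. \<forall>i\<in>I1. a i \<bullet> x \<noteq> b i \<longrightarrow> a i \<bullet> y < b i"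
    using assms finite_I1 by (intro eventually_inactive) (auto simp: \<Theta>_def)
  then show ?thesis by eventually_elim (force simp: active1_def)
qed

lemma eventually_active2_subset:
  assumes "x \<in> C"
  shows "\<forall>\<^sub>F y in nhds x. active2 a I2 y \<subseteq> active2 a I2 x"
proof -
  have "\<forall>\<^sub>F y in nhds x. \<forall>i\<in>I2. a i \<bullet> x \<noteq> 0 \<longrightarrow> a i \<bullet> y < 0"
    using assms finite_I2 by (intro eventually_inactive) (auto simp: C_def)
  then show ?thesis by eventually_elim (force simp: active2_def)
qed

lemma eventually_active_subset:
  assumes "x \<in> \<Theta>" "x \<in> C"
  shows "\<forall>\<^sub>F y in nhds x. active y \<subseteq> active x"
  using eventually_active1_subset[OF assms(1)] eventually_active2_subset[OF assms(2)]
  by eventually_elim (auto simp: active_def)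

lemma eventually_in_\<Theta>:
  assumes "x \<in> \<Theta>" "\<And>i. i \<in> active1 a b I1 x \<Longrightarrow> a i \<bullet> u \<le> 0"
  shows "\<forall>\<^sub>F t in at_right 0. x + t *\<^sub>R u \<in> \<Theta>"
  unfolding \<Theta>_def mem_Collect_eq
  by (rule eventually_feasible_direction)
    (use assms finite_I1 in \<open>auto simp: \<Theta>_def active1_def\<close>)

lemma eventually_in_C:
  assumes "x \<in> C" "\<And>i. i \<in> active2 a I2 x \<Longrightarrow> a i \<bullet> u \<le> 0"
  shows "\<forall>\<^sub>F t in at_right 0. x + t *\<^sub>R u \<in> C"
  unfolding C_def mem_Collect_eq
  by (rule eventually_feasible_direction)
    (use assms finite_I2 in \<open>auto simp: C_def active2_def\<close>)

text \<open>This gives necessity of \<open>C_face a (active x) Q \<noteq> {}\<close>: the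
  displacement towards a nearby feasible point is itself a witness. The converse is
  \<open>eventually_active_eq\<close>.\<close>

lemma C_face_active:
  assumes "x \<in> \<Theta>" "x \<in> C" "y \<in> \<Theta>" "y \<in> C" "active y \<subseteq> active x"
  shows "y - x \<in> C_face a (active x) (active y)"
proof -
  \<comment> \<open>Disjointness guarantees that \<open>i\<close> is active at both points for the
    same constraint, with the same right-hand side.\<close>
  have "a i \<bullet> (y - x) = 0" if "i \<in> active y" for i
    using that assms(5) disjoint
    by (auto simp: active_def active1_def active2_def inner_diff_right)
  moreover have "a i \<bullet> (y - x) < 0" if "i \<in> active x" "i \<notin> active y" for i
    using that assms(3,4) by (auto simp: active_def active1_def active2_def \<Theta>_def C_def
        inner_diff_right order_less_le)
  ultimately show ?thesis by (simp add: C_face_def)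
qed

text \<open>For small \<open>t > 0\<close> no new constraint becomes active, those in
  \<open>Q\<close> stay active because \<open>u\<close> is orthogonal to them, and the remaining
  ones become slack because \<open>u\<close> decreases them strictly.\<close>

lemma eventually_active_eq:
  assumes "x \<in> \<Theta>" "x \<in> C" "Q \<subseteq> active x" "u \<in> C_face a (active x) Q"
  shows "\<forall>\<^sub>F t in at_right 0. x + t *\<^sub>R u \<in> \<Theta> \<and> x + t *\<^sub>R u \<in> C \<and> active (x + t *\<^sub>R u) = Q"
proof -
  have u: "a i \<bullet> u = 0" if "i \<in> Q" for i
    using that assms(4) by (auto simp: C_face_def)
  have u': "a i \<bullet> u < 0" if "i \<in> active x" "i \<notin> Q" for i
    using that assms(4) by (auto simp: C_face_def)
  have le: "a i \<bullet> u \<le> 0" if "i \<in> active x" for i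
    using u[of i] u'[of i] that by (cases "i \<in> Q") auto
  have "\<forall>\<^sub>F t in at_right 0. x + t *\<^sub>R u \<in> \<Theta>" "\<forall>\<^sub>F t in at_right 0. x + t *\<^sub>R u \<in> C"
    using assms(1,2) le by (auto intro!: eventually_in_\<Theta> eventually_in_C simp: active_def)
  then show ?thesis
    using eventually_along_direction[OF eventually_active_subset[OF assms(1,2)], of u]
      eventually_at_right_less[of 0]
  proof eventually_elim
    case (elim t)
    have iff: "i \<in> active (x + t *\<^sub>R u) \<longleftrightarrow> a i \<bullet> u = 0" if "i \<in> active x" for i
      using that \<open>0 < t\<close> disjoint
      by (auto simp: active_def active1_def active2_def inner_add_right)
    have "active (x + t *\<^sub>R u) = Q"
    proof (intro equalityI subsetI)
      fix i assume i: "i \<in> active (x + t *\<^sub>R u)"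
      then have "i \<in> active x" using elim(3) by blast
      then show "i \<in> Q" using iff[of i] i u'[of i] by force
    next
      fix i assume "i \<in> Q"
      then show "i \<in> active (x + t *\<^sub>R u)" using iff[of i] u[of i] assms(3) by blast
    qed
    then show ?case using elim by simp
  qed
qed

section \<open>The Frechet normal cone at a graph point with strictly positive multipliers\<close>

lemma frechet_normal_wrt_subset:
  assumes "x \<in> \<Theta>" "x \<in> C" and P: "P \<subseteq> active1 a b I1 x"
    and c: "\<And>i. i \<in> P \<Longrightarrow> c i > 0" and xs: "xs = (\<Sum>i\<in>P. c i *\<^sub>R a i)"
  shows "frechet_normal_wrt (C \<times> UNIV) (x, xs) G
    \<subseteq> (A_cone a (active x) P \<inter> T_cone a (active x \<inter> I2)) \<times> B_cone a (active x \<inter> I1) P"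
proof clarify
  fix z w assume zw: "(z, w) \<in> frechet_normal_wrt (C \<times> UNIV) (x, xs) G"
  have finP: "finite P" using P finite_active1 finite_subset by blast
  have PQ: "P \<subseteq> active x" using P by (auto simp: active_def)
  have xsP: "xs \<in> convex_cone hull (a ` P)"
    unfolding xs by (rule sum_in_convex_cone_hull) (use c in force)
  \<comment> \<open>By polarity only \<open>u\<close> in \<open>B_cone\<close> has to be tested.
    Moving \<open>x\<close> along such \<open>u\<close> keeps \<open>P\<close> active, so
    \<open>xs\<close> remains a normal and the path \<open>(x + t u, xs)\<close> stays in the
    graph.\<close>
  have "z \<in> A_cone a (active x) P"
    unfolding A_cone_eq_polar[OF finite_active PQ]
  proof clarify
    fix u assume u: "u \<in> B_cone a (active x) P"
    have le: "a i \<bullet> u \<le> 0" if "i \<in> active x" for i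
      using u that by (auto simp: B_cone_def T_cone_def)
    have "\<forall>\<^sub>F t in at_right 0. x + t *\<^sub>R u \<in> \<Theta>" "\<forall>\<^sub>F t in at_right 0. x + t *\<^sub>R u \<in> C"
      using assms(1,2) le by (auto intro!: eventually_in_\<Theta> eventually_in_C simp: active_def)
    then have "\<forall>\<^sub>F t in at_right 0. (x, xs) + t *\<^sub>R (u, 0) \<in> G \<inter> (C \<times> UNIV)"
    proof eventually_elim
      case (elim t)
      have "P \<subseteq> active1 a b I1 (x + t *\<^sub>R u)"
        using P u by (auto simp: active1_def B_cone_def inner_add_right)
      then have "xs \<in> convex_cone hull (a ` active1 a b I1 (x + t *\<^sub>R u))"
        using xsP by (rule convex_cone_hull_image_mono)
      then show ?case using elim by (simp add: mem_G_iff)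
    qed
    from frechet_normal_wrt_direction[OF zw this] show "z \<bullet> u \<le> 0" by simp
  qed
  \<comment> \<open>This comes from the first clause of the definition,
    \<open>z + p *\<^sub>R zs \<in> D\<close>, and not from the limes superior.\<close>
  moreover have "z \<in> T_cone a (active x \<inter> I2)"
  proof -
    obtain p where p: "p > 0" "x + p *\<^sub>R z \<in> C"
      using zw by (auto simp: frechet_normal_wrt_def)
    then show ?thesis
      by (auto simp: T_cone_def active_Int_I2 active2_def C_def inner_add_right mult_le_0_iff)
  qed
  moreover have "w \<in> B_cone a (active x \<inter> I1) P"
  proof -
    \<comment> \<open>Adding multiples of an active \<open>a i\<close> to \<open>xs\<close> keeps it
      in the normal cone at \<open>x\<close>.\<close>
    have le: "a i \<bullet> w \<le> 0" if i: "i \<in> active1 a b I1 x" for i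
    proof -
      have "xs + t *\<^sub>R a i \<in> convex_cone hull (a ` active1 a b I1 x)" if "0 < t" for t
        using convex_cone_hull_image_mono[OF P xsP] i that
        by (simp add: convex_cone_hull_add convex_cone_hull_mul hull_inc)
      then have "\<forall>\<^sub>F t in at_right 0. (x, xs) + t *\<^sub>R (0, a i) \<in> G \<inter> (C \<times> UNIV)"
        using assms(1,2) by (intro eventually_mono[OF eventually_at_right_less]) (simp add: mem_G_iff)
      from frechet_normal_wrt_direction[OF zw this] show ?thesis by (simp add: inner_commute)
    qed
    moreover have "a i \<bullet> w = 0" if i: "i \<in> P" for i
    proof -
      \<comment> \<open>Since \<open>c i > 0\<close>, a small multiple of \<open>a i\<close> can
        also be subtracted, which makes the test two-sided and yields an equation.\<close>
      have "xs - t *\<^sub>R a i \<in> convex_cone hull (a ` active1 a b I1 x)" if "t < c i" for t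
      proof -
        have "xs - t *\<^sub>R a i = (\<Sum>j\<in>P. (c j - (if j = i then t else 0)) *\<^sub>R a j)"
          unfolding xs scaleR_diff_left sum_subtractf
          using finP i by (simp add: if_distrib[of "\<lambda>c. c *\<^sub>R _"] cong: if_cong)
        also have "\<dots> \<in> convex_cone hull (a ` P)"
          by (rule sum_in_convex_cone_hull) (use c that in \<open>auto simp: less_imp_le\<close>)
        finally show ?thesis by (rule convex_cone_hull_image_mono[OF P])
      qed
      moreover have "\<forall>\<^sub>F t in at_right 0. t < c i"
        using c[OF i] by (auto simp: eventually_at_right_field)
      ultimately have "\<forall>\<^sub>F t in at_right 0. xs - t *\<^sub>R a i \<in> convex_cone hull (a ` active1 a b I1 x)"
        by (simp add: eventually_mono)
      then have "\<forall>\<^sub>F t in at_right 0. (x, xs) + t *\<^sub>R (0, - a i) \<in> G \<inter> (C \<times> UNIV)"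
        by eventually_elim (simp add: mem_G_iff assms(1,2))
      from frechet_normal_wrt_direction[OF zw this] have "a i \<bullet> w \<ge> 0" by (simp add: inner_commute)
      then show ?thesis using le[of i] i P by force
    qed
    ultimately show ?thesis by (auto simp: B_cone_def T_cone_def active_Int_I1)
  qed
  ultimately show "(z \<in> A_cone a (active x) P \<inter> T_cone a (active x \<inter> I2)) \<and>
      w \<in> B_cone a (active x \<inter> I1) P" by blast
qed

lemma frechet_normal_wrt_supset:
  assumes "x \<in> \<Theta>" "x \<in> C" and P: "P \<subseteq> active1 a b I1 x"
    and c: "\<And>i. i \<in> P \<Longrightarrow> c i > 0" and xs: "xs = (\<Sum>i\<in>P. c i *\<^sub>R a i)"
  shows "(A_cone a (active x) P \<inter> T_cone a (active x \<inter> I2)) \<times> B_cone a (active x \<inter> I1) P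
    \<subseteq> frechet_normal_wrt (C \<times> UNIV) (x, xs) G"
proof clarify
  fix z w assume zA: "z \<in> A_cone a (active x) P" and zT: "z \<in> T_cone a (active x \<inter> I2)"
    and w: "w \<in> B_cone a (active x \<inter> I1) P"
  have finP: "finite P" using P finite_active1 finite_subset by blast
  have PQ: "P \<subseteq> active x" using P by (auto simp: active_def)
  have xsP: "xs \<in> convex_cone hull (a ` P)"
    unfolding xs by (rule sum_in_convex_cone_hull) (use c in force)
  have "\<forall>\<^sub>F t in at_right 0. x + t *\<^sub>R z \<in> C"
    by (rule eventually_in_C) (use assms(2) zT in \<open>auto simp: T_cone_def active_Int_I2\<close>)
  then have "\<forall>\<^sub>F t in at_right 0. t > 0 \<and> x + t *\<^sub>R z \<in> C"
    using eventually_at_right_less[of 0] by eventually_elim simp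
  then have "\<exists>p>0. x + p *\<^sub>R z \<in> C"
    using eventually_happens[of _ "at_right (0::real)"] by fastforce
  moreover
  \<comment> \<open>A stronger statement than the Limsup condition: the inner product itself is
    nonpositive at all nearby graph points.\<close>
  have "\<forall>\<^sub>F v in nhds x \<times>\<^sub>F nhds xs. v \<in> G \<inter> (C \<times> UNIV) \<longrightarrow> (z, w) \<bullet> (v - (x, xs)) \<le> 0"
  proof -
    from eventually_prodI[OF eventually_active1_subset[OF assms(1)] eventually_mem_hull_imp_mem]
    show ?thesis
    proof eventually_elim
      case (elim v)
      obtain y ys where v: "v = (y, ys)" by fastforce
      show ?case
      proof
        assume "v \<in> G \<inter> (C \<times> UNIV)"
        then have y: "y \<in> \<Theta>" "y \<in> C" and ys: "ys \<in> convex_cone hull (a ` active1 a b I1 y)"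
          by (auto simp: v mem_G_iff)
        have sub: "active1 a b I1 y \<subseteq> active1 a b I1 x" using elim by (simp add: v)
        \<comment> \<open>The local cone property is used with \<open>J\<close> the active set of
          \<open>y\<close>: thus \<open>xs\<close> is normal at \<open>y\<close> and can be tested
          against \<open>x\<close>.\<close>
        have "active1 a b I1 y \<subseteq> I1" by (auto simp: active1_def)
        then have "xs \<in> convex_cone hull (a ` active1 a b I1 y)"
          using elim ys by (auto simp: v)
        then have "xs \<bullet> (x - y) \<le> 0"
          using normal_cone_map_eq[OF y(1)] assms(1) y(1) by (auto simp: normal_cone_map_def)
        then have "(\<Sum>i\<in>P. c i * (a i \<bullet> (x - y))) \<le> 0" by (simp add: xs inner_sum_left)
        \<comment> \<open>Indices of \<open>P\<close> are active at \<open>x\<close> and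
          \<open>y\<close> is feasible, so the terms are nonnegative while their sum is nonpositive.
          All terms vanish, and as \<open>c i > 0\<close> the constraints in \<open>P\<close> remain
          active at \<open>y\<close>.\<close>
        moreover have nonneg: "c i * (a i \<bullet> (x - y)) \<ge> 0" if "i \<in> P" for i
          using that P c[OF that] y(1)
          by (intro mult_nonneg_nonneg) (auto simp: active1_def \<Theta>_def inner_diff_right)
        ultimately have "(\<Sum>i\<in>P. c i * (a i \<bullet> (x - y))) = 0"
          by (simp add: sum_nonneg order_antisym)
        then have "\<forall>i\<in>P. c i * (a i \<bullet> (x - y)) = 0"
          using sum_nonneg_eq_0_iff[OF finP, of "\<lambda>i. c i * (a i \<bullet> (x - y))"] nonneg by simp
        then have "a i \<bullet> (y - x) = 0" if "i \<in> P" for i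
          using c[OF that] that by (force simp: inner_diff_right)
        moreover have "a i \<bullet> (y - x) \<le> 0" if "i \<in> active x" for i
          using that y by (auto simp: active_def active1_def active2_def \<Theta>_def C_def inner_diff_right)
        ultimately have "y - x \<in> B_cone a (active x) P" by (auto simp: B_cone_def T_cone_def)
        then have "z \<bullet> (y - x) \<le> 0"
          using zA by (simp add: A_cone_eq_polar[OF finite_active PQ])
        \<comment> \<open>The inner product splits as
          \<open>z \<bullet> (y - x) + ys \<bullet> w - xs \<bullet> w\<close>, whose three parts
          are now treated.\<close>
        moreover have "xs \<bullet> w = 0"
          using w by (simp add: xs inner_sum_left B_cone_def)
        moreover have "ys \<bullet> w \<le> 0"
          by (rule convex_cone_hull_inner_nonpos[OF ys])
            (use w sub in \<open>auto simp: B_cone_def T_cone_def active_Int_I1\<close>)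
        ultimately show "(z, w) \<bullet> (v - (x, xs)) \<le> 0"
          by (simp add: v inner_diff_right inner_commute)
      qed
    qed
  qed
  then have "\<forall>\<^sub>F v in at (x, xs) within (G \<inter> (C \<times> UNIV)). (z, w) \<bullet> (v - (x, xs)) \<le> 0"
    unfolding nhds_prod[symmetric] eventually_at_filter by eventually_elim simp
  then have "\<forall>\<^sub>F v in at (x, xs) within (G \<inter> (C \<times> UNIV)).
      ereal (((z, w) \<bullet> (v - (x, xs))) / norm (v - (x, xs))) \<le> 0"
    by (rule eventually_mono) (simp add: divide_nonpos_nonneg)
  then have "Limsup (at (x, xs) within (G \<inter> (C \<times> UNIV)))
      (\<lambda>v. ereal (((z, w) \<bullet> (v - (x, xs))) / norm (v - (x, xs)))) \<le> 0"
    by (rule Limsup_bounded)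
  ultimately show "(z, w) \<in> frechet_normal_wrt (C \<times> UNIV) (x, xs) G"
    by (simp add: frechet_normal_wrt_def)
qed

section \<open>Passage from Frechet normals to limiting normals\<close>

definition admissible :: "'a \<Rightarrow> 'a \<Rightarrow> (nat set \<times> nat set) set" where
  "admissible x xs = {(Q, P). Q \<subseteq> active x \<and> C_face a (active x) Q \<noteq> {} \<and>
     P \<in> P_family a b I1 x xs \<and> P \<subseteq> Q \<inter> I1}"

definition normal_piece :: "nat set \<Rightarrow> nat set \<Rightarrow> ('a \<times> 'a) set" where
  "normal_piece Q P = (A_cone a Q P \<inter> T_cone a (Q \<inter> I2)) \<times> B_cone a (Q \<inter> I1) P"

lemma closed_Union_normal_piece: "closed (\<Union>(Q, P)\<in>admissible x xs. normal_piece Q P)"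
proof (rule closed_UN)
  have "admissible x xs \<subseteq> Pow (active x) \<times> Pow (active x)" by (auto simp: admissible_def)
  then show "finite (admissible x xs)"
    by (rule finite_subset) (simp add: finite_active)
  show "\<forall>QP\<in>admissible x xs. closed (case QP of (Q, P) \<Rightarrow> normal_piece Q P)"
    unfolding normal_piece_def admissible_def
    by (auto intro!: closed_Times closed_Int closed_A_cone closed_T_cone closed_B_cone
        intro: finite_subset[OF _ finite_active])
qed

text \<open>At a nearby graph point, \<open>Q\<close> is its active set and \<open>P\<close> the
  support of a strictly positive representation of \<open>ys\<close>. The pair is admissible at the
  reference point because \<open>xs\<close> lies in every cone generated over \<open>I1\<close> that
  contains a sufficiently close \<open>ys\<close>.\<close>

lemma eventually_frechet_normal_wrt_subset:
  assumes "x \<in> \<Theta>" "x \<in> C"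
  shows "\<forall>\<^sub>F v in nhds (x, xs). v \<in> G \<inter> (C \<times> UNIV) \<longrightarrow>
    frechet_normal_wrt (C \<times> UNIV) v G \<subseteq> (\<Union>(Q, P)\<in>admissible x xs. normal_piece Q P)"
proof -
  from eventually_prodI[OF eventually_active_subset[OF assms] eventually_mem_hull_imp_mem] show ?thesis
    unfolding nhds_prod
  proof eventually_elim
    case (elim v)
    obtain y ys where v: "v = (y, ys)" by fastforce
    show ?case
    proof
      assume "v \<in> G \<inter> (C \<times> UNIV)"
      then have y: "y \<in> \<Theta>" "y \<in> C" and ys: "ys \<in> convex_cone hull (a ` active1 a b I1 y)"
        by (auto simp: v mem_G_iff)
      obtain P c where P: "P \<subseteq> active1 a b I1 y" and c: "\<And>i. i \<in> P \<Longrightarrow> c i > 0"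
        and ysc: "ys = (\<Sum>i\<in>P. c i *\<^sub>R a i)"
        using convex_cone_hull_image_pos[OF finite_active1 ys] by metis
      have sub: "active y \<subseteq> active x" using elim by (simp add: v)
      have "ys \<in> convex_cone hull (a ` P)"
        unfolding ysc by (rule sum_in_convex_cone_hull) (use c in force)
      moreover have "P \<subseteq> I1" using P by (auto simp: active1_def)
      ultimately have "xs \<in> convex_cone hull (a ` P)" using elim by (auto simp: v)
      moreover have "P \<subseteq> active y \<inter> I1" using P by (simp add: active_Int_I1)
      moreover from this have "P \<subseteq> active1 a b I1 x" using sub active_Int_I1 by blast
      ultimately have "(active y, P) \<in> admissible x xs"
        using C_face_active[OF assms y sub] sub by (auto simp: admissible_def P_family_def)
      moreover have "frechet_normal_wrt (C \<times> UNIV) v G \<subseteq> normal_piece (active y) P"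
        using frechet_normal_wrt_subset[OF y P c ysc] by (simp add: v normal_piece_def)
      ultimately show "frechet_normal_wrt (C \<times> UNIV) v G
          \<subseteq> (\<Union>(Q, P)\<in>admissible x xs. normal_piece Q P)" by blast
    qed
  qed
qed

lemma normal_piece_subset_limiting_normal:
  assumes "x \<in> \<Theta>" "x \<in> C" "(Q, P) \<in> admissible x xs"
  shows "normal_piece Q P \<subseteq> limiting_normal_wrt (C \<times> UNIV) (x, xs) G"
proof
  fix zw assume zw: "zw \<in> normal_piece Q P"
  have Q: "Q \<subseteq> active x" and PQ: "P \<subseteq> Q \<inter> I1" and xsP: "xs \<in> convex_cone hull (a ` P)"
    using assms(3) by (auto simp: admissible_def P_family_def)
  obtain u where u: "u \<in> C_face a (active x) Q" using assms(3) by (auto simp: admissible_def)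
  have finP: "finite P" using PQ finite_I1 finite_subset by blast
  obtain P' c where P': "P' \<subseteq> P" and c: "\<And>i. i \<in> P' \<Longrightarrow> c i > 0"
    and xs: "xs = (\<Sum>i\<in>P'. c i *\<^sub>R a i)"
    using convex_cone_hull_image_pos[OF finP xsP] by metis
  \<comment> \<open>Admissibility allows zero multipliers of \<open>xs\<close> on \<open>P\<close>.
    Moving by \<open>t *\<^sub>R s\<close> raises each multiplier by \<open>t\<close>, so that all
    are strictly positive and the exact Frechet formula applies with this \<open>P\<close>.\<close>
  define s where "s = (\<Sum>i\<in>P. a i)"
  have "\<forall>\<^sub>F t in at_right 0. (x, xs) + t *\<^sub>R (u, s) \<in> G \<inter> (C \<times> UNIV) \<and>
      zw \<in> frechet_normal_wrt (C \<times> UNIV) ((x, xs) + t *\<^sub>R (u, s)) G"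
    using eventually_active_eq[OF assms(1,2) Q u] eventually_at_right_less[of 0]
  proof eventually_elim
    case (elim t)
    let ?y = "x + t *\<^sub>R u"
    define d where "d i = (if i \<in> P' then c i else 0) + t" for i
    have d: "d i > 0" for i using c[of i] elim(2) by (simp add: d_def add_pos_pos)
    have "xs = (\<Sum>i\<in>P. (if i \<in> P' then c i else 0) *\<^sub>R a i)"
      unfolding xs by (rule sum.mono_neutral_cong_left) (use finP P' in auto)
    then have xst: "xs + t *\<^sub>R s = (\<Sum>i\<in>P. d i *\<^sub>R a i)"
      by (simp add: d_def s_def scaleR_add_left sum.distrib scaleR_sum_right)
    have P: "P \<subseteq> active1 a b I1 ?y" using PQ elim(1) active_Int_I1[of ?y] by auto
    have y: "?y \<in> \<Theta>" "?y \<in> C" using elim by auto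
    have "xs + t *\<^sub>R s \<in> convex_cone hull (a ` P)"
      unfolding xst by (rule sum_in_convex_cone_hull) (use d less_imp_le in blast)
    then have "xs + t *\<^sub>R s \<in> convex_cone hull (a ` active1 a b I1 ?y)"
      by (rule convex_cone_hull_image_mono[OF P])
    moreover have "zw \<in> frechet_normal_wrt (C \<times> UNIV) (?y, xs + t *\<^sub>R s) G"
      using frechet_normal_wrt_supset[OF y P d xst] zw elim(1) by (auto simp: normal_piece_def)
    ultimately show ?case using y by (simp add: mem_G_iff)
  qed
  then obtain \<epsilon> where \<epsilon>: "\<epsilon> > 0" and t: "\<And>t. 0 < t \<Longrightarrow> t < \<epsilon> \<Longrightarrow>
      (x, xs) + t *\<^sub>R (u, s) \<in> G \<inter> (C \<times> UNIV) \<and>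
      zw \<in> frechet_normal_wrt (C \<times> UNIV) ((x, xs) + t *\<^sub>R (u, s)) G"
    unfolding eventually_at_right_field by blast
  \<comment> \<open>The denominators start at 2, so that \<open>tk k < \<epsilon>\<close> is strict
    also for \<open>k = 0\<close>.\<close>
  define tk where "tk k = \<epsilon> * inverse (real (Suc (Suc k)))" for k
  have tk: "0 < tk k" "tk k < \<epsilon>" for k
    using \<epsilon> by (auto simp: tk_def field_simps add_pos_nonneg)
  have "tk \<longlonglongrightarrow> 0"
    unfolding tk_def
    using tendsto_mult_right_zero[OF LIMSEQ_Suc[OF LIMSEQ_inverse_real_of_nat]] by simp
  then have "(\<lambda>k. (x, xs) + tk k *\<^sub>R (u, s)) \<longlonglongrightarrow> (x, xs) + 0 *\<^sub>R (u, s)"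
    by (intro tendsto_intros)
  then have "(\<lambda>k. (x, xs) + tk k *\<^sub>R (u, s)) \<longlonglongrightarrow> (x, xs)" by (simp add: zero_prod_def[symmetric])
  then show "zw \<in> limiting_normal_wrt (C \<times> UNIV) (x, xs) G"
    \<comment> \<open>The vector \<open>zw\<close> is a Frechet normal at every point of the
      sequence, so the normals may be taken constant.\<close>
    unfolding limiting_normal_wrt_def mem_Collect_eq using t[OF tk]
    by (intro exI[of _ "\<lambda>k. (x, xs) + tk k *\<^sub>R (u, s)"] exI[of _ "\<lambda>_. zw"]) auto
qed

lemma limiting_normal_wrt_G:
  assumes "x \<in> \<Theta>" "x \<in> C"
  shows "limiting_normal_wrt (C \<times> UNIV) (x, xs) G =
    (\<Union>(Q, P)\<in>admissible x xs. normal_piece Q P)" (is "_ = ?U")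
proof
  show "?U \<subseteq> limiting_normal_wrt (C \<times> UNIV) (x, xs) G"
    using normal_piece_subset_limiting_normal[OF assms] by blast
  show "limiting_normal_wrt (C \<times> UNIV) (x, xs) G \<subseteq> ?U"
  proof
    fix zw assume "zw \<in> limiting_normal_wrt (C \<times> UNIV) (x, xs) G"
    then obtain zk zsk where lim: "zk \<longlonglongrightarrow> (x, xs)" "zsk \<longlonglongrightarrow> zw"
      and mem: "\<And>k. zk k \<in> G \<inter> (C \<times> UNIV)"
        "\<And>k. zsk k \<in> frechet_normal_wrt (C \<times> UNIV) (zk k) G"
      unfolding limiting_normal_wrt_def by blast
    have "\<forall>\<^sub>F k in sequentially. zk k \<in> G \<inter> (C \<times> UNIV) \<longrightarrow>
        frechet_normal_wrt (C \<times> UNIV) (zk k) G \<subseteq> ?U"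
      using filterlim_iff[THEN iffD1, OF lim(1)] eventually_frechet_normal_wrt_subset[OF assms]
      by blast
    \<comment> \<open>The union on the right is the same for all \<open>k\<close>; being closed, it
      contains the limit of the normals.\<close>
    then have "\<forall>\<^sub>F k in sequentially. zsk k \<in> ?U"
      by eventually_elim (use mem in blast)
    then show "zw \<in> ?U"
      using Lim_in_closed_set[OF closed_Union_normal_piece _ _ lim(2)] by simp
  qed
qed

end

section \<open>The formula for consecutive index ranges\<close>

theorem theorem3p2:
  fixes a :: "nat \<Rightarrow> real ^ 'n" and b :: "nat \<Rightarrow> real"
    and l1 l :: nat and I1 I2 Ibar :: "nat set"
    and \<Theta> C :: "(real ^ 'n) set" and xbar xsbar :: "real ^ 'n"
  assumes "l1 \<le> l"
    and "I1 = {1..l1}"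
    and "I2 = {l1 + 1..l}"
    and "\<Theta> = {x. \<forall>i\<in>I1. a i \<bullet> x \<le> b i}"
    and "C = {x. \<forall>i\<in>I2. a i \<bullet> x \<le> 0}"
    and "xbar \<in> C"
    and "(xbar, xsbar) \<in> gph (normal_cone_map \<Theta>)"
    and "Ibar = active1 a b I1 xbar \<union> active2 a I2 xbar"
  shows "limiting_normal_wrt (C \<times> UNIV) (xbar, xsbar) (gph (normal_cone_map \<Theta>)) =
    (\<Union>(Q, P) \<in> {(Q, P). Q \<subseteq> Ibar \<and> C_face a Ibar Q \<noteq> {} \<and>
                         P \<in> P_family a b I1 xbar xsbar \<and> P \<subseteq> Q \<inter> I1}.
       (A_cone a Q P \<inter> T_cone a (Q \<inter> I2)) \<times> B_cone a (Q \<inter> I1) P)"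
proof -
  interpret pp: polyhedral_pair a b I1 I2
    by unfold_locales (auto simp: assms(2,3))
  have \<Theta>: "\<Theta> = pp.\<Theta>" and C: "C = pp.C" and Ibar: "Ibar = pp.active xbar"
    using assms(4,5,8) by (auto simp: pp.\<Theta>_def pp.C_def pp.active_def)
  \<comment> \<open>Feasibility of \<open>xbar\<close> for \<open>\<Theta>\<close> is part of
    membership in the graph, since the normal cone map is empty elsewhere.\<close>
  have "xbar \<in> pp.\<Theta>" "xbar \<in> pp.C"
    using assms(6,7) by (auto simp: \<Theta> C pp.mem_G_iff)
  from pp.limiting_normal_wrt_G[OF this, of xsbar] show ?thesis
    unfolding \<Theta> C Ibar pp.admissible_def pp.normal_piece_def .
qed

end
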